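(* There is no $2$-geodetic digraph with minimum out-degree at least $2$ and order $9$ whose in-degree sequence is $(1,1,2,\dots,2,3,3)$, i.e. exactly two vertices have in-degree $1$, exactly two have in-degree $3$, and all others have in-degree $2$.
   Context: A digraph is $2$-geodetic if for any two vertices $u,v$ there is at most one directed walk from $u$ to $v$ of length at most $2$. Note $9=M(2,2)+2$ with $M(2,2)=1+2+4$. The in-degree sequence is the list of in-degrees in non-decreasing order. *)

theory Defs
  imports
    "Graph_Theory.Digraph"
    "Graph_Theory.Arc_Walk"
    "HOL-Library.Multiset"
begin

text \<open>
  Walks are arc lists, so two parallel arcs give two distinct walks. The vertices u and v
  need not be distinct, and the empty walk from u to u counts. Hence, for k at least 2,
  loops, parallel arcs and directed 2-cycles are all excluded.
\<close>

definition geodetic :: "nat \<Rightarrow> ('a, 'b) pre_digraph \<Rightarrow> bool" where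
  "geodetic k G \<longleftrightarrow>
     (\<forall>u\<in>verts G. \<forall>v\<in>verts G. \<forall>p q.
        pre_digraph.awalk G u p v \<and> length p \<le> k \<and>
        pre_digraph.awalk G u q v \<and> length q \<le> k \<longrightarrow> p = q)"

definition digraph_order :: "('a, 'b) pre_digraph \<Rightarrow> nat" where
  "digraph_order G = card (verts G)"

text \<open>The following two definitions are meaningful for finite vertex sets; the minimum also
  needs at least one vertex.\<close>

definition min_out_degree :: "('a, 'b) pre_digraph \<Rightarrow> nat" where
  "min_out_degree G = Min (out_degree G ` verts G)"

definition in_degree_sequence :: "('a, 'b) pre_digraph \<Rightarrow> nat list" where
  "in_degree_sequence G =
     sorted_list_of_multiset (image_mset (in_degree G) (mset_set (verts G)))"

end

theory Submission
  imports Defs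
begin

text \<open>
  The in-degrees sum to 18, so every out-degree is 2. By geodecity the vertices at distance at most 2
  to a fixed vertex form a tree, which has at most 9 vertices; at a vertex \<open>t\<close> of in-degree 3
  the in-neighbours therefore have total in-degree at most 5. Total 5 would place all nine vertices
  in the tree, and following the remaining out-arcs of its vertices gives a contradiction.
  So the total is 4, which forces the in-neighbours of \<open>t\<close> to be both vertices of in-degree 1 and
  one vertex of in-degree 2. Applied to both vertices of in-degree 3, this fixes almost all arcs,
  and the two cases (third in-neighbour common or not) are contradictory.
\<close>

section \<open>Adjacency relations of 2-geodetic digraphs of order 9 with all out-degrees 2\<close>

text \<open>Geodecity is split by the lengths of the two competing walks: 0 and 1
  (\<open>no_loop\<close>), 0 and 2 (\<open>no_2cycle\<close>), 1 and 2
  (\<open>no_shortcut\<close>), 2 and 2 (\<open>unique_middle\<close>). Lengths 1 and 1 would be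
  parallel arcs, which a relation cannot express.\<close>

locale two_geodetic_out2 =
  fixes V :: "'a set" and E :: "'a \<Rightarrow> 'a \<Rightarrow> bool"
  assumes finite_V: "finite V"
    and card_V: "card V = 9"
    and E_V: "E x y \<Longrightarrow> x \<in> V \<and> y \<in> V"
    and no_loop: "\<not> E x x"
    and no_2cycle: "E x y \<Longrightarrow> \<not> E y x"
    and no_shortcut: "E x y \<Longrightarrow> E y z \<Longrightarrow> \<not> E x z"
    and unique_middle: "E x y \<Longrightarrow> E y z \<Longrightarrow> E x y' \<Longrightarrow> E y' z \<Longrightarrow> y = y'"
    and out_2: "x \<in> V \<Longrightarrow> card {y. E x y} = 2"
begin

lemma finite_in: "finite {u. E u v}"
  by (rule finite_subset[OF _ finite_V]) (auto dest: E_V)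

lemma out_other:
  assumes "E x y"
  shows "\<exists>z. z \<noteq> y \<and> E x z"
proof -
  have "card {y. E x y} = 2" using out_2 E_V assms by blast
  then obtain a b where "{y. E x y} = {a, b}" "a \<noteq> b" by (meson card_2_iff)
  then have "E x a" "E x b" "a \<noteq> b" by blast+
  then show ?thesis by metis
qed

lemma out_pair:
  assumes "E x y" "E x z" "y \<noteq> z" "E x v"
  shows "v = y \<or> v = z"
proof -
  have "card {y. E x y} = 2" using out_2 E_V assms by blast
  then obtain a b where "{y. E x y} = {a, b}" "a \<noteq> b" by (meson card_2_iff)
  then have "y \<in> {a,b}" "z \<in> {a,b}" "v \<in> {a,b}" using assms by blast+
  then show ?thesis using assms(3) by blast
qed

lemma out_pair_ex:
  assumes "x \<in> V"
  obtains y z where "E x y" "E x z" "y \<noteq> z"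
proof -
  obtain a b where "{y. E x y} = {a, b}" "a \<noteq> b" using out_2[OF assms] by (meson card_2_iff)
  then show ?thesis using that by blast
qed

section \<open>Size of the in-tree of depth 2\<close>

text \<open>Distinct in-neighbours of \<open>t\<close> have disjoint in-neighbourhoods, since a
  common member would reach \<open>t\<close> through two middle vertices. Total in-degree thus
  becomes a number of vertices.\<close>

lemma card_second_in:
  "card {c. \<exists>w. E c w \<and> E w t} = (\<Sum>w\<in>{w. E w t}. card {c. E c w})"
proof -
  have "{c. \<exists>w. E c w \<and> E w t} = (\<Union>w\<in>{w. E w t}. {c. E c w})" by blast
  moreover have "{c. E c w} \<inter> {c. E c w'} = {}" if "E w t" "E w' t" "w \<noteq> w'" for w w'
    using unique_middle that by blast
  ultimately show ?thesis
    by (simp add: card_UN_disjoint finite_in)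
qed

text \<open>The three levels are disjoint: a coincidence between two of them would be a loop, a
  2-cycle or a shortcut.\<close>

lemma card_in_tree:
  "card (insert t ({w. E w t} \<union> {c. \<exists>w. E c w \<and> E w t})) =
    1 + card {w. E w t} + card {c. \<exists>w. E c w \<and> E w t}"
proof -
  have "finite {c. \<exists>w. E c w \<and> E w t}"
    by (rule finite_subset[OF _ finite_V]) (auto dest: E_V)
  moreover have "t \<notin> {w. E w t} \<union> {c. \<exists>w. E c w \<and> E w t}"
    using no_loop no_2cycle by blast
  moreover have "{w. E w t} \<inter> {c. \<exists>w. E c w \<and> E w t} = {}"
    using no_shortcut by blast
  ultimately show ?thesis by (simp add: finite_in card_Un_disjoint)
qed

lemma card_in_tree_le:
  assumes "t \<in> V"
  shows "1 + card {w. E w t} + card {c. \<exists>w. E c w \<and> E w t} \<le> 9"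
proof -
  have "insert t ({w. E w t} \<union> {c. \<exists>w. E c w \<and> E w t}) \<subseteq> V"
    using assms E_V by blast
  from card_mono[OF finite_V this] show ?thesis using card_in_tree card_V by metis
qed

section \<open>Excluding an in-tree that covers all vertices\<close>

text \<open>Since 1 + 3 + 5 = 9, the in-tree is all of \<open>V\<close>, and every arc outside it
  has to end in the second level \<open>C\<close>. These arcs give the maps \<open>f\<close> on
  \<open>C\<close> and \<open>z\<close> from \<open>W\<close> to \<open>C\<close>, besides the tree
  map \<open>g\<close> from \<open>C\<close> to \<open>W\<close>.\<close>

lemma card_second_in_neq_5:
  assumes t: "t \<in> V" and in3: "card {u. E u t} = 3"
  shows "card {c. \<exists>w. E c w \<and> E w t} \<noteq> 5"
proof
  assume 5: "card {c. \<exists>w. E c w \<and> E w t} = 5"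
  define W where "W = {w. E w t}"
  define C where "C = {c. \<exists>w. E c w \<and> E w t}"
  have V: "v = t \<or> v \<in> W \<or> v \<in> C" if "v \<in> V" for v
  proof -
    have "insert t (W \<union> C) \<subseteq> V" using t E_V unfolding W_def C_def by blast
    moreover have "card (insert t (W \<union> C)) = 9"
      using card_in_tree in3 5 unfolding W_def C_def by simp
    ultimately have "insert t (W \<union> C) = V"
      by (metis card_V card_subset_eq finite_V)
    then show ?thesis using that by blast
  qed
  have "\<forall>c. \<exists>w. c \<in> C \<longrightarrow> w \<in> W \<and> E c w" unfolding C_def W_def by blast
  then obtain g where g: "\<And>c. c \<in> C \<Longrightarrow> g c \<in> W" "\<And>c. c \<in> C \<Longrightarrow> E c (g c)" by metis
  have W: "E w t" if "w \<in> W" for w using that unfolding W_def by simp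
  \<comment> \<open>The second out-arc of \<open>c\<close> cannot end in \<open>t\<close> (shortcut
    past \<open>g c\<close>) nor in \<open>W\<close> (second middle vertex towards
    \<open>t\<close>).\<close>
  have "\<exists>c'. E c c' \<and> c' \<in> C" if c: "c \<in> C" for c
  proof -
    obtain c' where c': "c' \<noteq> g c" "E c c'" using out_other g c by blast
    have "c' \<noteq> t" using c' no_shortcut g c W by blast
    moreover have "c' \<notin> W" using c' unique_middle g c W by blast
    ultimately show ?thesis using V c' E_V by blast
  qed
  then obtain f where f: "\<And>c. c \<in> C \<Longrightarrow> f c \<in> C" "\<And>c. c \<in> C \<Longrightarrow> E c (f c)" by metis
  have "\<exists>c. E w c \<and> c \<in> C" if w: "w \<in> W" for w
  proof -
    obtain c where c: "c \<noteq> t" "E w c" using out_other W w by blast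
    have "c \<notin> W" using c no_shortcut w W by blast
    then show ?thesis using V c E_V by blast
  qed
  then obtain z where z: "\<And>w. w \<in> W \<Longrightarrow> z w \<in> C" "\<And>w. w \<in> W \<Longrightarrow> E w (z w)" by metis
  obtain x y where xy: "E t x" "E t y" "x \<noteq> y" using out_pair_ex t by blast
  have outC: "v \<in> C" if "E t v" for v
  proof -
    have "v \<noteq> t" "v \<notin> W" using that no_loop no_2cycle W by blast+
    then show ?thesis using V that E_V by blast
  qed
  have C_W: "c \<notin> W" if "c \<in> C" for c
    using that no_shortcut unfolding W_def C_def by blast
  have t_C: "t \<notin> C" using no_2cycle unfolding C_def by blast

  \<comment> \<open>Each fact from here to \<open>z4\<close> compares two short walks with the same
    ends. For instance, \<open>z2\<close> compares the walks from \<open>c\<close> through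
    \<open>g c\<close> and \<open>f c\<close>, and \<open>z4\<close> those from \<open>w\<close>
    through \<open>t\<close> and \<open>z w\<close>.\<close>
  have f1: "f c \<noteq> c" "f (f c) \<noteq> c" if "c \<in> C" for c
    using f that no_loop no_2cycle by metis+
  have g1: "g (f c) \<noteq> g c" if "c \<in> C" for c
    using f g that no_shortcut by metis
  have z1: "z (g c) \<noteq> c" "z (g c) \<noteq> f c" if "c \<in> C" for c
    using f g z that no_2cycle no_shortcut by metis+
  have z2: "z (g c) \<noteq> f (f c)" if "c \<in> C" for c
    using unique_middle[of c "g c" "z (g c)" "f c"] f g z that C_W by metis
  have out_t: "\<not> E t (f c)" if "E t c" for c
    using that f outC no_shortcut by blast
  have z3: "\<not> E t (z w)" if "w \<in> W" for w
    using that z W no_shortcut by blast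
  have z4: "\<not> E t (f (z w))" if "w \<in> W" for w
    using that z f W t_C unique_middle by metis
  txt \<open>The images of \<open>z\<close> lie in \<open>D\<close>, and so do their images under \<open>f\<close>. If \<open>f\<close> leaves
    \<open>D\<close>, this leaves too few values for \<open>z\<close>; otherwise \<open>f\<close> is a 3-cycle on \<open>D\<close>, and
    \<open>z (g a)\<close> avoids the whole cycle.\<close>
  define D where "D = {c \<in> C. \<not> E t c}"
  have "D = C - {x, y}" unfolding D_def using xy out_pair by blast
  moreover have "x \<in> C" "y \<in> C" using outC xy by blast+
  ultimately have D3: "card D = 3" using 5 xy(3)
    by (simp add: C_def[symmetric] card_Diff_subset)
  have zD: "z w \<in> D" "f (z w) \<in> D" if "w \<in> W" for w
    unfolding D_def using that z z3 z4 f by blast+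
  have split: "\<exists>c. D = {a, b, c} \<and> c \<noteq> a \<and> c \<noteq> b" if "a \<in> D" "b \<in> D" "a \<noteq> b" for a b
  proof -
    have "card (D - {a, b}) = 1" using that D3 by (simp add: card_Diff_subset)
    then obtain c where "D - {a, b} = {c}" by (auto simp: card_1_singleton_iff)
    then show ?thesis using that by blast
  qed
  have fD: "f a \<in> D" if a: "a \<in> D" for a
  proof (rule ccontr)
    assume n: "f a \<notin> D"
    define x where "x = f a"
    have aC: "a \<in> C" using a D_def by simp
    have x: "x \<in> C" "E t x" using n aC f unfolding x_def D_def by auto
    define b where "b = f x"
    have b: "b \<in> D" using out_t[OF x(2)] f x unfolding b_def D_def by blast
    have "b \<noteq> a" using f1 aC unfolding b_def x_def by blast
    then obtain c where c: "D = {a, b, c}" "c \<noteq> a" "c \<noteq> b" using split a b by metis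
    \<comment> \<open>The value \<open>a\<close> is excluded because \<open>f (z w)\<close> lies in
      \<open>D\<close> while \<open>f a\<close> does not.\<close>
    have za: "z w = b \<or> z w = c" if "w \<in> W" for w
      using zD[OF that] c(1) n by auto
    have zx: "z (g x) = c" using za g x z1 unfolding b_def by metis
    have cC: "c \<in> C" "b \<in> C" using c(1) unfolding D_def by auto
    have fb: "f b \<noteq> c" using z2 x zx unfolding b_def by metis
    have "z (g c) = b" using za z1 g cC by metis
    then have "f b \<in> D" using zD g cC by metis
    then have fb: "f b = a" using fb f1 cC c(1) by blast
    have za': "z (g a) = c" using za g z2 aC unfolding b_def x_def by metis
    \<comment> \<open>Now \<open>f\<close> runs through the 3-cycle \<open>a\<close>,
      \<open>x\<close>, \<open>b\<close>. By \<open>g1\<close>, \<open>g\<close> differs at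
      consecutive vertices, so it takes all three values in \<open>W\<close> there.\<close>
    have gd: "g a \<noteq> g x" "g x \<noteq> g b" "g b \<noteq> g a"
      using g1 aC x cC fb unfolding b_def x_def by metis+
    have "{g a, g x, g b} = W"
    proof (rule card_subset_eq)
      show "finite W" using in3 finite_in unfolding W_def by blast
      show "{g a, g x, g b} \<subseteq> W" using g aC x cC by blast
      show "card {g a, g x, g b} = card W" using gd in3 unfolding W_def by simp
    qed
    \<comment> \<open>Both \<open>g a\<close> and \<open>g x\<close> are sent by \<open>z\<close> to
      \<open>c\<close>, whereas \<open>z (g c)\<close> is not \<open>c\<close>. The remaining value
      gives \<open>z (g b) = b\<close>, against \<open>z1\<close>.\<close>
    then have "g c = g b" using g cC za' zx z1 by (metis empty_iff insert_iff)
    then show False using \<open>z (g c) = b\<close> z1 cC by metis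
  qed
  obtain a where a: "a \<in> D" using D3 by fastforce
  have inC: "d \<in> C" if "d \<in> D" for d using that unfolding D_def by blast
  have "a \<noteq> f a" "f a \<noteq> f (f a)" "a \<noteq> f (f a)"
    using f1 f inC a by metis+
  then have "D = {a, f a, f (f a)}" using split[of a "f a"] fD a by fastforce
  moreover have "z (g a) \<in> D" using zD g inC a by blast
  ultimately show False using z1 z2 inC a by auto
qed

section \<open>Two vertices of in-degree 3 with the same in-neighbours\<close>

text \<open>The in-tree of \<open>t1\<close> has 1 + 3 + 4 = 8 vertices and misses only
  \<open>t2\<close>. So the out-arcs of \<open>t1\<close> and \<open>t2\<close>, and one out-arc of
  each second in-neighbour, end in the four-element set \<open>C\<close>, which is too small for
  them.\<close>

lemma common_in_neighbours_impossible:
  assumes N: "{u. E u t1} = {s1, s2, w}" "{u. E u t2} = {s1, s2, w}" "t1 \<noteq> t2"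
    and d: "card {s1, s2, w} = 3"
    and i: "{u. E u s1} = {p1}" "{u. E u s2} = {p2}" "{u. E u w} = {q1, q2}" "q1 \<noteq> q2"
  shows False
proof -
  define C where "C = {p1, p2, q1, q2}"
  have Et: "E u t \<longleftrightarrow> u \<in> {s1, s2, w}" if "t = t1 \<or> t = t2" for t u
    using N that by blast
  have Es: "E u s1 \<longleftrightarrow> u = p1" "E u s2 \<longleftrightarrow> u = p2" "E u w \<longleftrightarrow> u = q1 \<or> u = q2" for u
    using i by blast+
  have C: "u \<in> C \<longleftrightarrow> (\<exists>v. E u v \<and> E v t1)" for u
    unfolding C_def using Es Et by auto
  have C2: "u \<in> C \<longleftrightarrow> (\<exists>v. E u v \<and> E v t2)" for u
    unfolding C_def using Es Et by auto
  have c2: "{c. \<exists>v. E c v \<and> E v t1} = C" using C by blast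
  have ss: "s1 \<noteq> s2" "s1 \<noteq> w" "s2 \<noteq> w" using d by (auto simp: card_insert_if split: if_splits)
  have cC: "card C = 4"
    using card_second_in[of t1] unfolding c2 N(1) using ss i by simp
  have "V = insert t2 (insert t1 ({s1, s2, w} \<union> C))"
  proof (rule card_subset_eq[symmetric])
    show "finite V" by (rule finite_V)
    show "insert t2 (insert t1 ({s1, s2, w} \<union> C)) \<subseteq> V"
      using E_V N C by auto
    have "t2 \<notin> C" using C2 no_2cycle by blast
    moreover have "t2 \<notin> {s1, s2, w}" using N no_loop by blast
    moreover have "card (insert t1 ({s1, s2, w} \<union> C)) = 8"
      using card_in_tree[of t1] unfolding c2 N(1) cC d by simp
    ultimately show "card (insert t2 (insert t1 ({s1, s2, w} \<union> C))) = card V"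
      using N(3) card_V by (subst card_insert_disjoint) (auto simp: C_def)
  qed
  then have V: "v = t1 \<or> v = t2 \<or> v \<in> {s1, s2, w} \<or> v \<in> C" if "v \<in> V" for v
    using that by blast
  have tV: "t1 \<in> V" "t2 \<in> V" using E_V N by blast+
  have outt: "v \<in> C" if "E t v" "t = t1 \<or> t = t2" for v t
  proof -
    have "v \<notin> {s1, s2, w}" using that no_2cycle Et by blast
    moreover have "v \<noteq> t1" "v \<noteq> t2" using that no_loop no_2cycle Et N
      by (metis (mono_tags, lifting) C C2 no_shortcut unique_middle)+
    ultimately show ?thesis using V E_V that by blast
  qed
  have "\<exists>c'. E c c' \<and> c' \<in> C" if c: "c \<in> C" for c
  proof -
    obtain u where u: "E c u" "E u t1" "E u t2" using C Et c by blast
    obtain c' where c': "c' \<noteq> u" "E c c'" using out_other u by blast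
    have "c' \<noteq> t1" "c' \<noteq> t2" using c' no_shortcut u by blast+
    moreover have "c' \<notin> {s1, s2, w}" using c' unique_middle u N by blast
    ultimately show ?thesis using V c' E_V by blast
  qed
  then obtain f where f: "\<And>c. c \<in> C \<Longrightarrow> f c \<in> C" "\<And>c. c \<in> C \<Longrightarrow> E c (f c)" by metis
  obtain x y where xy: "E t1 x" "E t1 y" "x \<noteq> y" using out_pair_ex tV by blast
  obtain x' y' where xy': "E t2 x'" "E t2 y'" "x' \<noteq> y'" using out_pair_ex tV by blast
  have s: "E s1 t1" "E s1 t2" using Et by blast+
  have disj: "\<not> (E t1 c \<and> E t2 c)" for c
    using unique_middle s N(3) by blast
  \<comment> \<open>\<open>t1\<close> and \<open>t2\<close> share no out-neighbour, since
    \<open>s1\<close> points to both; their out-pairs therefore partition \<open>C\<close>.\<close>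
  have "{x, y, x', y'} = C"
  proof (rule card_subset_eq)
    show "finite C" unfolding C_def by simp
    show "{x, y, x', y'} \<subseteq> C" using outt xy xy' by blast
    have "x \<noteq> x'" "x \<noteq> y'" "y \<noteq> x'" "y \<noteq> y'" using disj xy xy' by blast+
    then show "card {x, y, x', y'} = card C" using cC xy(3) xy'(3) by simp
  qed
  then have tC: "E t1 c \<longleftrightarrow> \<not> E t2 c" if "c \<in> C" for c
    using that xy xy' disj by blast
  \<comment> \<open>An arc from \<open>t1\<close> to \<open>f c\<close> would be a shortcut past
    \<open>c\<close>, so \<open>f\<close> switches between the two out-pairs.\<close>
  have ft: "E t2 (f c)" if "c \<in> C" "E t1 c" for c
    using f tC that no_shortcut by blast
  have ft': "E t1 (f c)" if "c \<in> C" "E t2 c" for c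
    using f tC that no_shortcut by blast
  have inj: "f c \<noteq> f d" if "c \<in> C" "d \<in> C" "c \<noteq> d" "E t1 c \<and> E t1 d \<or> E t2 c \<and> E t2 d" for c d
    using that f unique_middle by metis
  have f1: "f c \<noteq> c" "f (f c) \<noteq> c" if "c \<in> C" for c
    using f that no_loop no_2cycle by metis+
  have q: "q1 \<in> C" "q2 \<in> C" "E q1 w" "E q2 w" unfolding C_def using i by auto
  have fq: "f q1 \<noteq> q2" "f q2 \<noteq> q1" using q f no_shortcut by metis+
  have nq: "\<not> (E t q1 \<and> E t q2)" for t using unique_middle q i(4) by blast
  txt \<open>\<open>f\<close> maps the two out-neighbours of each of \<open>t1\<close>, \<open>t2\<close> bijectively to those of the other;
    \<open>q1\<close> and \<open>q2\<close> lie in different pairs.\<close>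
  have two: "c = e" if "E t a" "E t c" "E t e" "a \<noteq> c" "a \<noteq> e" for a c e t
    using out_pair that by blast
  have False if h: "E t q1" "E t' q2" "{t, t'} = {t1, t2}" for t t'
  proof -
    have t: "t = t1 \<and> t' = t2 \<or> t = t2 \<and> t' = t1" using h(3) by (auto simp: doubleton_eq_iff)
    have fq1: "E t' (f q1)" and fq2: "E t (f q2)" and ffq2: "E t' (f (f q2))" "E t (f (f q1))"
      using t h(1,2) ft ft' q f by metis+
    \<comment> \<open>\<open>q1\<close>, \<open>f q2\<close> and \<open>f (f q1)\<close> become
      three distinct out-neighbours of \<open>t\<close>. The last two differ because
      \<open>f\<close> is injective on the out-pair of \<open>t'\<close>, which consists of
      \<open>q2\<close> and \<open>f q1\<close>.\<close>
    have "f (f q1) \<noteq> q1" "f (f q1) \<noteq> f q2"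
      using f1 q inj[of "f q1" q2] f fq fq1 h(2) t by metis+
    then show False using two[OF h(1) _ fq2, of "f (f q1)"] ffq2 fq by metis
  qed
  then show False using tC q nq by (metis insert_commute)
qed

section \<open>Two vertices of in-degree 3 with different third in-neighbours\<close>

text \<open>The eight named vertices are distinct, which leaves one further vertex \<open>v\<close>.
  The in-degrees of \<open>w\<close> and \<open>w'\<close> force \<open>v\<close> to point to both;
  then both \<open>t1\<close> and \<open>t2\<close> must point to \<open>v\<close>, giving
  \<open>s1\<close> two walks to \<open>v\<close>.\<close>

lemma distinct_in_neighbours_impossible:
  assumes N: "{u. E u t1} = {s1, s2, w}" "{u. E u t2} = {s1, s2, w'}" "t1 \<noteq> t2"
    and d: "card {s1, s2, w} = 3" "card {s1, s2, w'} = 3" "w \<noteq> w'"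
    and i: "{u. E u s1} = {p1}" "{u. E u s2} = {p2}" "card {u. E u w} = 2" "card {u. E u w'} = 2"
  shows False
proof -
  have ss: "s1 \<noteq> s2" "s1 \<noteq> w" "s2 \<noteq> w" "s1 \<noteq> w'" "s2 \<noteq> w'"
    using d by (auto simp: card_insert_if split: if_splits)
  have E: "E s1 t1" "E s2 t1" "E w t1" "E s1 t2" "E s2 t2" "E w' t2" "E p1 s1" "E p2 s2"
    using N i by blast+
  have in': "u = s1 \<or> u = s2 \<or> u = w" if "E u t1" for u using that N by blast
  have in2: "u = s1 \<or> u = s2 \<or> u = w'" if "E u t2" for u using that N by blast
  have in3: "E u s1 \<Longrightarrow> u = p1" "E u s2 \<Longrightarrow> u = p2" for u using i by blast+
  have outs: "v = t1 \<or> v = t2" if "E s1 v \<or> E s2 v" for v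
    using that out_pair E N(3) by blast
  have p12: "p1 \<noteq> p2" using E ss unique_middle by metis
  have p: "p \<noteq> t1 \<and> p \<noteq> t2 \<and> p \<noteq> s1 \<and> p \<noteq> s2 \<and> p \<noteq> w \<and> p \<noteq> w'"
    if "p = p1 \<or> p = p2" for p
    using that E no_2cycle no_loop no_shortcut outs N(3) by metis
  have t: "t1 \<noteq> s1" "t1 \<noteq> s2" "t1 \<noteq> w" "t1 \<noteq> w'" "t2 \<noteq> s1" "t2 \<noteq> s2" "t2 \<noteq> w" "t2 \<noteq> w'"
    using E no_loop no_shortcut by metis+
  have "card {t1, t2, s1, s2, w, w', p1, p2} = 8"
    using ss d(3) N(3) p12 p[of p1] p[of p2] t by (simp add: card_insert_if eq_commute)
  moreover have "{t1, t2, s1, s2, w, w', p1, p2} \<subseteq> V" using E E_V by blast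
  ultimately have "card (V - {t1, t2, s1, s2, w, w', p1, p2}) = 1"
    using card_V by (simp add: card_Diff_subset)
  then obtain v where v: "V - {t1, t2, s1, s2, w, w', p1, p2} = {v}"
    by (auto simp: card_1_singleton_iff)
  have V: "u \<in> {t1, t2, s1, s2, w, w', p1, p2, v}" if "u \<in> V" for u
    using v that by blast
  \<comment> \<open>\<open>s1\<close> and \<open>s2\<close> point only to \<open>t1\<close> and
    \<open>t2\<close>. An arc from \<open>p1\<close> or \<open>p2\<close> to \<open>w\<close> would
    open a second walk of length 2 to \<open>t1\<close>.\<close>
  have inw: "u = t2 \<or> u = w' \<or> u = v" if "E u w" for u
  proof -
    have "u \<noteq> t1" "u \<noteq> w" using that E no_loop no_2cycle by blast+
    moreover have "u \<noteq> s1" "u \<noteq> s2" using that outs no_loop E no_2cycle t by blast+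
    moreover have "u \<noteq> p1" "u \<noteq> p2" using that unique_middle E ss by blast+
    ultimately show ?thesis using V that E_V by blast
  qed
  have inw': "u = t1 \<or> u = w \<or> u = v" if "E u w'" for u
  proof -
    have "u \<noteq> t2" "u \<noteq> w'" using that E no_loop no_2cycle by blast+
    moreover have "u \<noteq> s1" "u \<noteq> s2" using that outs no_loop E no_2cycle t by blast+
    moreover have "u \<noteq> p1" "u \<noteq> p2" using that unique_middle E ss by blast+
    ultimately show ?thesis using V that E_V by blast
  qed
  obtain a b where ab: "{u. E u w} = {a, b}" "a \<noteq> b" using i(3) by (meson card_2_iff)
  obtain a' b' where ab': "{u. E u w'} = {a', b'}" "a' \<noteq> b'" using i(4) by (meson card_2_iff)
  have mem: "E a w" "E b w" "E a' w'" "E b' w'" using ab ab' by blast+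
  \<comment> \<open>Of the three candidates for in-neighbours of \<open>w\<close>, \<open>t2\<close>
    and \<open>w'\<close> exclude each other, so \<open>v\<close> is one of the two; likewise for
    \<open>w'\<close>. Then any arc between \<open>w\<close> and \<open>w'\<close> is a shortcut
    from \<open>v\<close>, which determines both in-neighbourhoods.\<close>
  have "\<not> (E t2 w \<and> E w' w)" "\<not> (E t1 w' \<and> E w w')" using E no_shortcut by blast+
  then have vw: "E v w" "E v w'" using inw inw' mem ab(2) ab'(2) by metis+
  then have "\<not> E w' w" "\<not> E w w'" using no_shortcut by blast+
  then have tw: "E t2 w" "E t1 w'" using inw inw' mem ab(2) ab'(2) by metis+
  have only: "u = p1 \<or> u = p2 \<or> u = v" if "u \<in> V" "u \<notin> {t1, t2, s1, s2, w, w'}" for u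
    using V that by blast
  obtain x where x: "E t1 x" "x \<noteq> w'" using out_other tw by blast
  obtain x' where x': "E t2 x'" "x' \<noteq> w" using out_other tw by blast
  obtain y where y: "E w y" "y \<noteq> t1" using out_other E by blast
  obtain y' where y': "E w' y'" "y' \<noteq> t2" using out_other E by blast
  have tp: "t1 \<noteq> p1" "t1 \<noteq> p2" "t2 \<noteq> p1" "t2 \<noteq> p2" "w \<noteq> p1" "w \<noteq> p2" "w' \<noteq> p1" "w' \<noteq> p2"
    using E no_2cycle no_shortcut by blast+
  have "x \<notin> {t1, t2, s1, s2, w, w'}"
    using x in2[of t1] in3 tp E no_loop no_2cycle no_shortcut by blast
  then have x3: "x = p1 \<or> x = p2 \<or> x = v" using only x E_V by blast
  have "x' \<notin> {t1, t2, s1, s2, w, w'}"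
    using x' in3 tp E no_loop no_2cycle no_shortcut by blast
  then have x3': "x' = p1 \<or> x' = p2 \<or> x' = v" using only x' E_V by blast
  have "y \<notin> {t1, t2, s1, s2, w, w'}"
    using y in2 in3 tp ss d(3) \<open>\<not> E w w'\<close> no_loop by blast
  moreover have "y \<noteq> v" using y vw no_2cycle by blast
  ultimately have y3: "y = p1 \<or> y = p2" using only y E_V by blast
  have "y' \<notin> {t1, t2, s1, s2, w, w'}"
    using y' in' in3 tp ss d(3) \<open>\<not> E w' w\<close> no_loop by blast
  moreover have "y' \<noteq> v" using y' vw no_2cycle by blast
  ultimately have y3': "y' = p1 \<or> y' = p2" using only y' E_V by blast
  \<comment> \<open>So \<open>y\<close> and \<open>y'\<close> are \<open>p1\<close> and
    \<open>p2\<close> in some order. \<open>x\<close> is neither: \<open>x = y\<close> gives a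
    shortcut past \<open>t1\<close> from \<open>w\<close>, and \<open>x = y'\<close> one past
    \<open>w'\<close> from \<open>t1\<close>. Symmetrically for \<open>x'\<close>, so only
    \<open>v\<close> remains.\<close>
  have yy: "y \<noteq> y'" using unique_middle vw y y' d(3) by blast
  have "x \<noteq> y" "x' \<noteq> y'" using x x' y y' E no_shortcut by blast+
  moreover have "x \<noteq> y'" "x' \<noteq> y"
    using x x' y y' tw no_shortcut by blast+
  ultimately have "x = v" "x' = v" using x3 x3' y3 y3' yy by blast+
  then show False using unique_middle[of s1 t1 v t2] E x x' N(3) by blast
qed

section \<open>In-neighbours of a vertex of in-degree 3\<close>

text \<open>Three positive in-degrees with sum at most 4 are 1, 1, 1 or 1, 1, 2 in some order, and
  only two vertices have in-degree 1.\<close>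

lemma in_neighbours_of_indegree_3:
  assumes t: "t \<in> V" "card {u. E u t} = 3"
    and ge1: "\<And>v. v \<in> V \<Longrightarrow> card {u. E u v} \<ge> 1"
    and s: "{v \<in> V. card {u. E u v} = 1} = {s1, s2}" "s1 \<noteq> s2"
  shows "\<exists>w. {u. E u t} = {s1, s2, w} \<and> card {u. E u w} = 2"
proof -
  obtain a b c where abc: "{u. E u t} = {a, b, c}" "a \<noteq> b" "b \<noteq> c" "a \<noteq> c"
    using t(2) by (metis card_3_iff)
  define d where "d v = card {u. E u v}" for v
  have "(\<Sum>w\<in>{w. E w t}. d w) \<le> 4"
    using card_in_tree_le[OF t(1)] card_second_in_neq_5[OF t] card_second_in[of t] t(2)
    unfolding d_def by linarith
  then have sum: "d a + d b + d c \<le> 4" unfolding abc(1) using abc(2-4) by (simp add: add.assoc)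
  have V: "a \<in> V" "b \<in> V" "c \<in> V" using abc(1) E_V by blast+
  have ge: "d a \<ge> 1" "d b \<ge> 1" "d c \<ge> 1" using V ge1 unfolding d_def by blast+
  have one: "d v = 1 \<longleftrightarrow> v = s1 \<or> v = s2" if "v \<in> V" for v
    using that s(1) unfolding d_def by blast
  have no3: "\<not> (d a = 1 \<and> d b = 1 \<and> d c = 1)" using one V abc(2-4) by metis
  then consider "d a = 1" "d b = 1" "d c = 2" | "d a = 1" "d b = 2" "d c = 1"
    | "d a = 2" "d b = 1" "d c = 1" using ge sum by linarith
  then show ?thesis
  proof cases
    case 1
    then have "{a, b} = {s1, s2}" using one V abc(2) by auto
    then show ?thesis using 1(3) abc(1) unfolding d_def by (metis insert_commute)
  next
    case 2
    then have "{a, c} = {s1, s2}" using one V abc(4) by auto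
    then show ?thesis using 2(2) abc(1) unfolding d_def by (metis insert_commute)
  next
    case 3
    then have "{b, c} = {s1, s2}" using one V abc(3) by auto
    then show ?thesis using 3(1) abc(1) unfolding d_def by (metis insert_commute)
  qed
qed

lemma indegree_sequence_impossible:
  assumes ge1: "\<And>v. v \<in> V \<Longrightarrow> card {u. E u v} \<ge> 1"
    and c1: "card {v \<in> V. card {u. E u v} = 1} = 2"
    and c3: "card {v \<in> V. card {u. E u v} = 3} = 2"
  shows False
proof -
  obtain s1 s2 where s: "{v \<in> V. card {u. E u v} = 1} = {s1, s2}" "s1 \<noteq> s2"
    using c1 by (meson card_2_iff)
  obtain t1 t2 where t: "{v \<in> V. card {u. E u v} = 3} = {t1, t2}" "t1 \<noteq> t2"
    using c3 by (meson card_2_iff)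
  then have tV: "t1 \<in> V" "t2 \<in> V" and t3: "card {u. E u t1} = 3" "card {u. E u t2} = 3"
    by blast+
  obtain w where w: "{u. E u t1} = {s1, s2, w}" "card {u. E u w} = 2"
    using in_neighbours_of_indegree_3[OF tV(1) t3(1) ge1 s] by blast
  obtain w' where w': "{u. E u t2} = {s1, s2, w'}" "card {u. E u w'} = 2"
    using in_neighbours_of_indegree_3[OF tV(2) t3(2) ge1 s] by blast
  have "card {u. E u s1} = 1" "card {u. E u s2} = 1" using s(1) by blast+
  then obtain p1 p2 where p: "{u. E u s1} = {p1}" "{u. E u s2} = {p2}"
    by (auto simp: card_1_singleton_iff)
  obtain q1 q2 where q: "{u. E u w} = {q1, q2}" "q1 \<noteq> q2" using w(2) by (meson card_2_iff)
  show False
  proof (cases "w = w'")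
    case True
    then show False
      using common_in_neighbours_impossible[OF w(1) _ t(2) _ p q] w'(1) t3(1) w(1) by simp
  next
    case False
    then show False
      using distinct_in_neighbours_impossible[OF w(1) w'(1) t(2) _ _ False p w(2) w'(2)]
        t3 w(1) w'(1) by simp
  qed
qed

end

section \<open>From arcs and walks to the adjacency relation\<close>

lemma two_geodetic_out2I:
  fixes G :: "('a, 'b) pre_digraph"
  assumes "fin_digraph G" and geo: "geodetic 2 G"
    and out: "\<And>x. x \<in> verts G \<Longrightarrow> out_degree G x = 2" and "card (verts G) = 9"
  shows "two_geodetic_out2 (verts G) (\<lambda>x y. (x, y) \<in> arcs_ends G)"
    and "\<And>v. in_degree G v = card {u. (u, v) \<in> arcs_ends G}"
proof -
  interpret fin_digraph G by fact
  have arc: "\<exists>e\<in>arcs G. tail G e = x \<and> head G e = y" if "(x, y) \<in> arcs_ends G" for x y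
    using that by (auto simp: arcs_ends_def arc_to_ends_def)
  have same: "p = q" if "awalk u p v" "awalk u q v" "length p \<le> 2" "length q \<le> 2" for u v p q
    using geo that unfolding geodetic_def by (meson awalk_hd_in_verts awalk_last_in_verts)
  \<comment> \<open>Parallel arcs would be two walks of length 1, so an arc is determined by its
    ends. This lets degrees, which count arcs, be read as numbers of neighbours.\<close>
  have simple: "e = e'" if "e \<in> arcs G" "e' \<in> arcs G" "tail G e = tail G e'" "head G e = head G e'" for e e'
    using same[of "tail G e" "[e]" "head G e" "[e']"] that by (simp add: awalk_simps)
  show "in_degree G v = card {u. (u, v) \<in> arcs_ends G}" for v
  proof -
    have "bij_betw (tail G) (in_arcs G v) {u. (u, v) \<in> arcs_ends G}"
      unfolding bij_betw_def inj_on_def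
      using simple by (auto simp: arcs_ends_def arc_to_ends_def image_def)
    then show ?thesis unfolding in_degree_def by (rule bij_betw_same_card)
  qed
  have od: "out_degree G v = card {u. (v, u) \<in> arcs_ends G}" for v
  proof -
    have "bij_betw (head G) (out_arcs G v) {u. (v, u) \<in> arcs_ends G}"
      unfolding bij_betw_def inj_on_def
      using simple by (auto simp: arcs_ends_def arc_to_ends_def image_def)
    then show ?thesis unfolding out_degree_def by (rule bij_betw_same_card)
  qed
  have V: "x \<in> verts G \<and> y \<in> verts G" if "(x, y) \<in> arcs_ends G" for x y
    using arc[OF that] by auto
  show "two_geodetic_out2 (verts G) (\<lambda>x y. (x, y) \<in> arcs_ends G)"
  proof
    show "finite (verts G)" by simp
    show "card (verts G) = 9" by fact
    show "x \<in> verts G \<and> y \<in> verts G" if "(x, y) \<in> arcs_ends G" for x y using V[OF that] .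
    show "(x, x) \<notin> arcs_ends G" for x
    proof
      assume "(x, x) \<in> arcs_ends G"
      then obtain a where "a \<in> arcs G" "tail G a = x" "head G a = x" using arc by blast
      then show False using same[of x "[a]" x "[]"] by (auto simp: awalk_simps)
    qed
    show "(y, x) \<notin> arcs_ends G" if h: "(x, y) \<in> arcs_ends G" for x y
    proof
      assume "(y, x) \<in> arcs_ends G"
      then obtain a b where "a \<in> arcs G" "tail G a = x" "head G a = y"
        "b \<in> arcs G" "tail G b = y" "head G b = x"
        using arc h by metis
      then show False using same[of x "[a, b]" x "[]"] by (auto simp: awalk_simps)
    qed
    show "(x, z) \<notin> arcs_ends G" if h: "(x, y) \<in> arcs_ends G" "(y, z) \<in> arcs_ends G" for x y z
    proof
      assume "(x, z) \<in> arcs_ends G"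
      then obtain a b c where "a \<in> arcs G" "tail G a = x" "head G a = y"
        "b \<in> arcs G" "tail G b = y" "head G b = z" "c \<in> arcs G" "tail G c = x" "head G c = z"
        using arc h by metis
      then show False using same[of x "[a, b]" z "[c]"] by (auto simp: awalk_simps)
    qed
    show "y = y'" if h: "(x, y) \<in> arcs_ends G" "(y, z) \<in> arcs_ends G"
      "(x, y') \<in> arcs_ends G" "(y', z) \<in> arcs_ends G" for x y z y'
    proof -
      obtain a b where "a \<in> arcs G" "tail G a = x" "head G a = y"
        "b \<in> arcs G" "tail G b = y" "head G b = z" using arc h(1,2) by metis
      moreover obtain c d where "c \<in> arcs G" "tail G c = x" "head G c = y'"
        "d \<in> arcs G" "tail G d = y'" "head G d = z" using arc h(3,4) by metis
      ultimately show ?thesis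
        using same[of x "[a, b]" z "[c, d]"] by (auto simp: awalk_simps)
    qed
    show "card {y. (x, y) \<in> arcs_ends G} = 2" if "x \<in> verts G" for x
      using out[OF that] od by simp
  qed
qed

section \<open>Degree sums\<close>

context fin_digraph
begin

lemma sum_out_degree: "(\<Sum>v\<in>verts G. out_degree G v) = card (arcs G)"
proof -
  have "card (\<Union>v\<in>verts G. out_arcs G v) = (\<Sum>v\<in>verts G. out_degree G v)"
    unfolding out_degree_def by (rule card_UN_disjoint) auto
  moreover have "(\<Union>v\<in>verts G. out_arcs G v) = arcs G" by auto
  ultimately show ?thesis by simp
qed

lemma sum_in_degree: "(\<Sum>v\<in>verts G. in_degree G v) = card (arcs G)"
proof -
  have "card (\<Union>v\<in>verts G. in_arcs G v) = (\<Sum>v\<in>verts G. in_degree G v)"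
    unfolding in_degree_def by (rule card_UN_disjoint) auto
  moreover have "(\<Union>v\<in>verts G. in_arcs G v) = arcs G" by auto
  ultimately show ?thesis by simp
qed

end

section \<open>Reading off the degrees\<close>

theorem theorem7:
  shows "\<not> (\<exists>G :: ('a, 'b) pre_digraph.
           fin_digraph G \<and> geodetic 2 G \<and> min_out_degree G \<ge> 2 \<and> digraph_order G = 9 \<and>
           in_degree_sequence G = [1, 1, 2, 2, 2, 2, 2, 3, 3])"
proof
  assume "\<exists>G :: ('a, 'b) pre_digraph.
           fin_digraph G \<and> geodetic 2 G \<and> min_out_degree G \<ge> 2 \<and> digraph_order G = 9 \<and>
           in_degree_sequence G = [1, 1, 2, 2, 2, 2, 2, 3, 3]"
  then obtain G :: "('a, 'b) pre_digraph" where
    G: "fin_digraph G" "geodetic 2 G" "min_out_degree G \<ge> 2" "card (verts G) = 9"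
      "in_degree_sequence G = [1, 1, 2, 2, 2, 2, 2, 3, 3]"
    unfolding digraph_order_def by blast
  interpret fin_digraph G by (rule G)
  define M where "M = image_mset (in_degree G) (mset_set (verts G))"
  \<comment> \<open>Sorting keeps multiplicities, so the list determines how many vertices have each
    in-degree.\<close>
  have M: "M = mset [1, 1, 2, 2, 2, 2, 2, 3, 3]"
    using G(5) unfolding in_degree_sequence_def M_def by (metis mset_sorted_list_of_multiset)
  have cnt: "card {v \<in> verts G. in_degree G v = k} = count M k" for k
    unfolding M_def count_image_mset' by (simp add: eq_commute[of k])
  have c: "card {v \<in> verts G. in_degree G v = 1} = 2" "card {v \<in> verts G. in_degree G v = 3} = 2"
    unfolding cnt M by simp_all
  have ge1: "in_degree G v \<ge> 1" if "v \<in> verts G" for v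
  proof -
    have "in_degree G v \<in># M" unfolding M_def using that by simp
    then show ?thesis unfolding M by auto
  qed
  have "(\<Sum>v\<in>verts G. in_degree G v) = sum_mset M"
    unfolding M_def by (simp add: sum_unfold_sum_mset)
  also have "\<dots> = 18" unfolding M by simp
  finally have "card (arcs G) = 18"
    using sum_in_degree by simp
  then have "(\<Sum>v\<in>verts G. out_degree G v) = 18" using sum_out_degree by simp
  moreover have ge2: "out_degree G v \<ge> 2" if "v \<in> verts G" for v
    using G(3) that unfolding min_out_degree_def by (meson Min_le dual_order.trans finite_imageI finite_verts imageI)
  \<comment> \<open>The in-degree sum 2 * 1 + 5 * 2 + 2 * 3 = 18 equals 9 * 2, so out-degrees of at
    least 2 leave no room for a larger one.\<close>
  ultimately have "(\<Sum>v\<in>verts G. out_degree G v) = (\<Sum>v\<in>verts G. 2)" using G(4) by simp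
  then have out: "out_degree G v = 2" if "v \<in> verts G" for v
    using sum_mono_inv[of "\<lambda>_. 2" "verts G" "out_degree G"] ge2 that by fastforce
  have I: "two_geodetic_out2 (verts G) (\<lambda>x y. (x, y) \<in> arcs_ends G)"
    and in_degree: "in_degree G v = card {u. (u, v) \<in> arcs_ends G}" for v
    using two_geodetic_out2I[OF G(1,2) out G(4)] by blast+
  interpret two_geodetic_out2 "verts G" "\<lambda>x y. (x, y) \<in> arcs_ends G" by (rule I)
  show False by (rule indegree_sequence_impossible[folded in_degree, OF ge1 c])
qed

end
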